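(* The optimal single-stage cost $J^*(P,Q)$ is not necessarily continuous in $P$ under weak convergence, even when $\mathbb{X},\mathbb{Y},\mathbb{U}$ are compact and $c$ is bounded and continuous. That is: there exist compact sets $\mathbb{X},\mathbb{Y},\mathbb{U}$ (subsets of Euclidean spaces), a bounded continuous function $c:\mathbb{X}\times\mathbb{U}\to\mathbb{R}$, a channel $Q$ from $\mathbb{X}$ to $\mathbb{Y}$, and probability measures $P, P_1,P_2,\dots$ on $\mathbb{X}$ such that $P_n\to P$ weakly but $J^*(P_n,Q)\not\to J^*(P,Q)$.
   Context: $\mathbb{X}\subset\mathbb{R}^n$, $\mathbb{Y}\subset\mathbb{R}^m$ and $\mathbb{U}$ (a subset of some Euclidean space) are Borel sets; $\mathcal{P}(\mathbb{X})$ is the set of Borel probability measures on $\mathbb{X}$. A channel $Q$ is a stochastic kernel from $\mathbb{X}$ to $\mathbb{Y}$: $Q(\cdot|x)$ is a Borel probability measure on $\mathbb{Y}$ for every $x$, and $x\mapsto Q(A|x)$ is Borel measurable for every Borel $A\subset\mathbb{Y}$. $\Gamma$ is the set of Borel measurable functions $\gamma:\mathbb{Y}\to\mathbb{U}$. For a cost function $c:\mathbb{X}\times\mathbb{U}\to\mathbb{R}$, $$J(P,Q,\gamma)=\int_{\mathbb{X}}\int_{\mathbb{Y}}c(x,\gamma(y))\,Q(dy|x)\,P(dx),\qquad J^*(P,Q)=\inf_{\gamma\in\Gamma}J(P,Q,\gamma).$$ *)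

theory Defs
  imports "HOL-Probability.Probability"
begin

(* A Borel set X is given the trace sigma-algebra restrict_space borel X, which is the Borel
   sigma-algebra of the subspace topology. Measures on X have underlying space X. *)

definition prob_measures :: "'a::topological_space set \<Rightarrow> 'a measure set" where
  "prob_measures X = space (prob_algebra (restrict_space borel X))"

(* Measurability into prob_algebra N says exactly that every Q x with x in X is a probability
   measure on N and that x \<mapsto> Q x A is measurable for every A in sets N. Values of Q outside X
   are irrelevant. *)
definition channels ::
    "'a::topological_space set \<Rightarrow> 'b::topological_space set \<Rightarrow> ('a \<Rightarrow> 'b measure) set" where
  "channels X Y = restrict_space borel X \<rightarrow>\<^sub>M prob_algebra (restrict_space borel Y)"

definition policies ::
    "'b::topological_space set \<Rightarrow> 'u::topological_space set \<Rightarrow> ('b \<Rightarrow> 'u) set" where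
  "policies Y U = restrict_space borel Y \<rightarrow>\<^sub>M restrict_space borel U"

(* The domains of integration X and Y are the underlying spaces of P and of the Q x. *)
definition cost ::
    "('a \<times> 'u \<Rightarrow> real) \<Rightarrow> 'a measure \<Rightarrow> ('a \<Rightarrow> 'b measure) \<Rightarrow> ('b \<Rightarrow> 'u) \<Rightarrow> real" where
  "cost c P Q \<gamma> = (\<integral>x. (\<integral>y. c (x, \<gamma> y) \<partial>Q x) \<partial>P)"

(* A real infimum: it is the intended one when c is bounded and measurable and U is nonempty,
   so that the set of costs is nonempty and bounded. *)
definition opt_cost ::
    "'b::topological_space set \<Rightarrow> 'u::topological_space set \<Rightarrow> ('a \<times> 'u \<Rightarrow> real) \<Rightarrow>
     'a measure \<Rightarrow> ('a \<Rightarrow> 'b measure) \<Rightarrow> real" where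
  "opt_cost Y U c P Q = (INF \<gamma> \<in> policies Y U. cost c P Q \<gamma>)"

(* The library's weak_conv_m is stated through distribution functions and covers only measures
   on the real line. *)
definition weakly_converges ::
    "'a::topological_space set \<Rightarrow> (nat \<Rightarrow> 'a measure) \<Rightarrow> 'a measure \<Rightarrow> bool" where
  "weakly_converges X Ps P \<longleftrightarrow>
     (\<forall>f :: 'a \<Rightarrow> real. continuous_on X f \<and> bounded (f ` X) \<longrightarrow>
        (\<lambda>i. \<integral>x. f x \<partial>Ps i) \<longlonglongrightarrow> (\<integral>x. f x \<partial>P))"

end

theory Submission
  imports Defs
begin

text \<open>With quadratic cost, let \<open>P\<close> be uniform on the points 0 and 1 of the unit interval, and \<open>Ps i\<close>
  uniform on \<open>1 / (i + 2)\<close> and 1. The channel reports 0 at 0 and 1 everywhere else, so it reveals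
  the state completely under \<open>P\<close> and nothing at all under \<open>Ps i\<close>.\<close>

text \<open>The copy of the real line inside \<open>Euclidean_space 1\<close>, whose elements are
  the sequences that vanish from index 1 on.\<close>

definition point :: "real \<Rightarrow> nat \<Rightarrow> real" where
  "point t = (\<lambda>j. if j = 0 then t else 0)"

definition segment :: "(nat \<Rightarrow> real) set" where
  "segment = point ` {0..1}"

lemma point_0 [simp]: "point t 0 = t"
  by (simp add: point_def)

lemma point_in_segment [simp]: "point t \<in> segment \<longleftrightarrow> 0 \<le> t \<and> t \<le> 1"
  by (auto simp: segment_def) (metis point_0 atLeastAtMost_iff image_iff)+

lemma continuous_point: "continuous_on A point"
proof (rule continuous_on_coordinatewise_then_product)
  show "continuous_on A (\<lambda>t. point t j)" for j
    by (cases "j = 0") (auto simp: point_def)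
qed

lemma continuous_on_first_coordinate: "continuous_on A (\<lambda>x :: nat \<Rightarrow> real. x 0)"
  by (rule continuous_on_subset[OF continuous_on_product_coordinates]) simp

lemma measurable_first_coordinate [measurable]:
  "(\<lambda>x. x 0) \<in> borel_measurable (restrict_space borel (A :: (nat \<Rightarrow> real) set))"
  by (intro borel_measurable_continuous_on_restrict continuous_on_first_coordinate)

text \<open>As a continuous image of an interval, \<open>segment\<close> is compact in the product
  topology; it lies inside \<open>Euclidean_space 1\<close>, so compactness passes to that
  subspace.\<close>

lemma compactin_segment: "compactin (Euclidean_space 1) segment"
proof -
  have "compact segment"
    unfolding segment_def by (intro compact_continuous_image continuous_point) auto
  then show ?thesis
    by (auto simp: Euclidean_space_def compactin_subtopology euclidean_product_topology
        segment_def point_def)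
qed

text \<open>A deterministic channel: a Dirac measure at the image of a map with a jump at the
  origin. This jump is the source of the discontinuity.\<close>

definition threshold_channel :: "(nat \<Rightarrow> real) \<Rightarrow> (nat \<Rightarrow> real) measure" where
  "threshold_channel x =
     return (restrict_space borel segment) (point (if x 0 = 0 then 0 else 1))"

lemma measurable_threshold:
  "(\<lambda>x. point (if x 0 = 0 then 0 else 1))
     \<in> restrict_space borel segment \<rightarrow>\<^sub>M restrict_space borel segment"
proof -
  have "(\<lambda>x. if x 0 = 0 then point 0 else point 1)
     \<in> restrict_space borel segment \<rightarrow>\<^sub>M restrict_space borel segment"
  proof (intro measurable_If measurable_const)
    show "{x \<in> space (restrict_space borel segment). x 0 = 0} \<in> sets (restrict_space borel segment)"
      by measurable
  qed (auto simp: space_restrict_space)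
  then show ?thesis
    by (simp add: if_distrib)
qed

lemma threshold_channel: "threshold_channel \<in> channels segment segment"
  unfolding channels_def threshold_channel_def
  by (rule measurable_compose[OF measurable_threshold measurable_return_prob_space])

text \<open>The push-forward of a fair coin. Every map out of the discrete coin space is measurable,
  and integrals become averages of two values.\<close>

definition two_point :: "real \<Rightarrow> (nat \<Rightarrow> real) measure" where
  "two_point a = distr (measure_pmf (bernoulli_pmf (1/2))) (restrict_space borel segment)
     (\<lambda>b. point (if b then 1 else a))"

lemma two_point_in_prob_measures:
  assumes "0 \<le> a" "a \<le> 1"
  shows "two_point a \<in> prob_measures segment"
  using assms unfolding prob_measures_def two_point_def space_prob_algebra
  by (auto simp: space_restrict_space intro!: measure_pmf.prob_space_distr)

lemma integral_two_point:
  fixes f :: "(nat \<Rightarrow> real) \<Rightarrow> real"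
  assumes "0 \<le> a" "a \<le> 1" and f: "f \<in> borel_measurable (restrict_space borel segment)"
  shows "(\<integral>x. f x \<partial>two_point a) = (f (point 1) + f (point a)) / 2"
proof -
  have "(\<integral>x. f x \<partial>two_point a) =
      (\<integral>b. f (point (if b then 1 else a)) \<partial>measure_pmf (bernoulli_pmf (1/2)))"
    unfolding two_point_def
    using assms by (intro integral_distr) (auto simp: space_restrict_space)
  then show ?thesis
    by (simp add: field_simps)
qed

definition quadratic_cost :: "(nat \<Rightarrow> real) \<times> (nat \<Rightarrow> real) \<Rightarrow> real" where
  "quadratic_cost = (\<lambda>(x, u). (x 0 - u 0)\<^sup>2)"

lemma continuous_quadratic_cost: "continuous_on A quadratic_cost"
  unfolding quadratic_cost_def case_prod_beta
  by (intro continuous_intros continuous_on_compose2[OF continuous_on_first_coordinate[of UNIV]]) auto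

text \<open>State 1 is always observed as 1, while state \<open>a\<close> is observed as 0 only if
  \<open>a = 0\<close>. Hence for \<open>a > 0\<close> the same action
  \<open>\<gamma> (point 1)\<close> has to serve both states.\<close>

lemma cost_two_point:
  assumes a: "0 \<le> a" "a \<le> 1" and \<gamma>: "\<gamma> \<in> policies segment segment"
  shows "cost quadratic_cost (two_point a) threshold_channel \<gamma> =
    ((1 - \<gamma> (point 1) 0)\<^sup>2 + (a - \<gamma> (point (if a = 0 then 0 else 1)) 0)\<^sup>2) / 2"
proof -
  have \<gamma>_meas [measurable]: "\<gamma> \<in> restrict_space borel segment \<rightarrow>\<^sub>M restrict_space borel segment"
    using \<gamma> by (simp add: policies_def)
  have \<gamma>_first [measurable]: "(\<lambda>y. \<gamma> y 0) \<in> borel_measurable (restrict_space borel segment)"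
    by (rule measurable_compose[OF \<gamma>_meas measurable_first_coordinate])
  have inner: "(\<integral>y. quadratic_cost (x, \<gamma> y) \<partial>threshold_channel x) =
      (x 0 - \<gamma> (point (if x 0 = 0 then 0 else 1)) 0)\<^sup>2" for x
    unfolding threshold_channel_def quadratic_cost_def
    by (subst integral_return) (auto simp: space_restrict_space)
  have [measurable]: "(\<lambda>x. \<gamma> (point (if x 0 = 0 then 0 else 1)) 0)
      \<in> borel_measurable (restrict_space borel segment)"
    by (rule measurable_compose[OF measurable_threshold \<gamma>_first])
  show ?thesis
    unfolding cost_def inner by (subst integral_two_point[OF a]) auto
qed

lemma policies_nonempty: "policies segment segment \<noteq> {}"
  unfolding policies_def using measurable_ident_sets by blast

text \<open>On the two states 0 and 1 the observation equals the state, so the identity policy makes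
  no error and attains the trivial lower bound.\<close>

lemma opt_cost_two_point_0:
  "opt_cost segment segment quadratic_cost (two_point 0) threshold_channel = 0"
proof -
  have id: "(\<lambda>y. y) \<in> policies segment segment"
    by (simp add: policies_def)
  have nonneg: "0 \<le> cost quadratic_cost (two_point 0) threshold_channel \<gamma>"
    if "\<gamma> \<in> policies segment segment" for \<gamma>
    using that by (simp add: cost_two_point)
  have "opt_cost segment segment quadratic_cost (two_point 0) threshold_channel
      \<le> cost quadratic_cost (two_point 0) threshold_channel (\<lambda>y. y)"
    unfolding opt_cost_def using id nonneg by (intro cINF_lower bdd_belowI2[of _ 0])
  also have "\<dots> = 0"
    using id by (simp add: cost_two_point)
  finally show ?thesis
    using nonneg policies_nonempty unfolding opt_cost_def
    by (intro antisym cINF_greatest) auto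
qed

text \<open>With an uninformative observation the policy amounts to a constant guess, whose mean
  square error is at least the variance of the state.\<close>

lemma opt_cost_two_point_ge:
  assumes "0 < a" "a \<le> 1"
  shows "(1 - a)\<^sup>2 / 4 \<le> opt_cost segment segment quadratic_cost (two_point a) threshold_channel"
  unfolding opt_cost_def
proof (rule cINF_greatest[OF policies_nonempty])
  fix \<gamma>
  assume \<gamma>: "\<gamma> \<in> policies segment segment"
  define v where "v = \<gamma> (point 1) 0"
  \<comment> \<open>Mean square error is variance plus squared bias; the mean of the two states is
    \<open>(1 + a) / 2\<close>.\<close>
  have "(1 - a)\<^sup>2 / 4 + (1 + a - 2 * v)\<^sup>2 / 4 = ((1 - v)\<^sup>2 + (a - v)\<^sup>2) / 2"
    by (simp add: power2_eq_square field_simps)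
  moreover have "0 \<le> (1 + a - 2 * v)\<^sup>2 / 4"
    by simp
  ultimately have "(1 - a)\<^sup>2 / 4 \<le> ((1 - v)\<^sup>2 + (a - v)\<^sup>2) / 2"
    by linarith
  then show "(1 - a)\<^sup>2 / 4 \<le> cost quadratic_cost (two_point a) threshold_channel \<gamma>"
    using assms \<gamma> by (simp add: cost_two_point v_def)
qed

text \<open>The integrals are averages of values of \<open>f\<close> at two points, one fixed and
  one moving continuously with \<open>a i\<close>.\<close>

lemma two_point_weakly_converges:
  assumes "\<And>i. 0 \<le> a i" "\<And>i. a i \<le> 1" and lim: "a \<longlonglongrightarrow> l"
  shows "weakly_converges segment (\<lambda>i. two_point (a i)) (two_point l)"
  unfolding weakly_converges_def
proof (intro allI impI, elim conjE)
  fix f :: "(nat \<Rightarrow> real) \<Rightarrow> real"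
  assume f: "continuous_on segment f"
  have l: "0 \<le> l" "l \<le> 1"
    using assms by (auto intro: LIMSEQ_le_const LIMSEQ_le_const2)
  have "continuous_on {0..1} (\<lambda>t. f (point t))"
    by (rule continuous_on_compose2[OF f continuous_point]) auto
  then have "(\<lambda>i. f (point (a i))) \<longlonglongrightarrow> f (point l)"
    by (rule continuous_on_tendsto_compose[OF _ lim]) (use assms l in auto)
  then have "(\<lambda>i. (f (point 1) + f (point (a i))) / 2) \<longlonglongrightarrow> (f (point 1) + f (point l)) / 2"
    by (intro tendsto_intros) auto
  then show "(\<lambda>i. \<integral>x. f x \<partial>two_point (a i)) \<longlonglongrightarrow> (\<integral>x. f x \<partial>two_point l)"
    using assms l f by (simp add: integral_two_point borel_measurable_continuous_on_restrict)
qed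

(* Euclidean_space n is R^n, realised as the sequences vanishing from index n on. Its topology is
   the subspace topology of the product topology on nat \<Rightarrow> real, the type class topology to which
   borel and continuous_on refer. *)
theorem theorem2p2:
  shows "\<exists>(n::nat) (m::nat) (k::nat)
      (X :: (nat \<Rightarrow> real) set) (Y :: (nat \<Rightarrow> real) set) (U :: (nat \<Rightarrow> real) set)
      (c :: (nat \<Rightarrow> real) \<times> (nat \<Rightarrow> real) \<Rightarrow> real)
      (Q :: (nat \<Rightarrow> real) \<Rightarrow> (nat \<Rightarrow> real) measure)
      (P :: (nat \<Rightarrow> real) measure) (Ps :: nat \<Rightarrow> (nat \<Rightarrow> real) measure).
      n \<ge> 1 \<and> m \<ge> 1 \<and> k \<ge> 1 \<and>
      compactin (Euclidean_space n) X \<and>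
      compactin (Euclidean_space m) Y \<and>
      compactin (Euclidean_space k) U \<and> U \<noteq> {} \<and>
      continuous_on (X \<times> U) c \<and> bounded (c ` (X \<times> U)) \<and>
      Q \<in> channels X Y \<and>
      P \<in> prob_measures X \<and> (\<forall>i. Ps i \<in> prob_measures X) \<and>
      weakly_converges X Ps P \<and>
      \<not> (\<lambda>i. opt_cost Y U c (Ps i) Q) \<longlonglongrightarrow> opt_cost Y U c P Q"
proof -
  \<comment> \<open>The offset 2 keeps \<open>a i\<close> at distance at least 1/2 from the other
    state 1, so the variances stay bounded away from 0.\<close>
  define a :: "nat \<Rightarrow> real" where "a i = 1 / real (i + 2)" for i
  have a: "0 < a i" "a i \<le> 1 / 2" "a i \<le> 1" for i
    by (auto simp: a_def field_simps)
  have "a \<longlonglongrightarrow> 0"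
    unfolding a_def by (rule LIMSEQ_ignore_initial_segment) (rule lim_1_over_n)
  then have weak: "weakly_converges segment (\<lambda>i. two_point (a i)) (two_point 0)"
    using a by (intro two_point_weakly_converges) (auto intro: less_imp_le)
  let ?J = "\<lambda>b. opt_cost segment segment quadratic_cost (two_point b) threshold_channel"
  have "1 / 16 \<le> ?J (a i)" for i
  proof -
    have "(1 / 2)\<^sup>2 \<le> (1 - a i)\<^sup>2"
      using a(2)[of i] by (intro power_mono) auto
    then show ?thesis
      using opt_cost_two_point_ge[OF a(1,3), of i] by (simp add: power2_eq_square)
  qed
  \<comment> \<open>A limit of values that are all at least 1/16 cannot be the optimal cost 0 at the
    limit measure.\<close>
  then have not_lim: "\<not> (\<lambda>i. ?J (a i)) \<longlonglongrightarrow> ?J 0"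
    using LIMSEQ_le_const[of "\<lambda>i. ?J (a i)" 0 "1 / 16"] opt_cost_two_point_0 by auto
  have "bounded (quadratic_cost ` (segment \<times> segment))"
  proof (rule boundedI)
    fix r
    assume "r \<in> quadratic_cost ` (segment \<times> segment)"
    then obtain s t where "s \<in> {0..1}" "t \<in> {0..1}" and r: "r = (s - t)\<^sup>2"
      by (auto simp: segment_def quadratic_cost_def)
    then have "\<bar>s - t\<bar> \<le> 1"
      by auto
    then show "norm r \<le> 1"
      by (simp add: r abs_square_le_1)
  qed
  moreover have "segment \<noteq> {}"
    by (simp add: segment_def)
  ultimately show ?thesis
    using compactin_segment continuous_quadratic_cost threshold_channel weak not_lim
      two_point_in_prob_measures[of 0] two_point_in_prob_measures[OF less_imp_le[OF a(1)] a(3)]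
    \<comment> \<open>The types select the witnesses: 1 serves for all three dimensions and
      \<open>segment\<close> for all three sets.\<close>
    by (intro exI[of _ 1] exI[of _ segment] exI[of _ quadratic_cost] exI[of _ threshold_channel]
        exI[of _ "two_point 0"] exI[of _ "\<lambda>i. two_point (a i)"]) auto
qed

end
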